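(* For every finite set $D$ of positive integers, every germ-maximal $D$-avoiding set $S\subseteq\mathbb{N}$ is rational (that is, eventually periodic).
   Context: $\mathbb{N}=\{0,1,2,\dots\}$. For $S\subseteq\mathbb{N}$ put $S_q=\sum_{n\in S}q^n$ for $q\in(0,1)$. For $S,S'\subseteq\mathbb{N}$ write $S'\preceq S$ (the germ order) iff there exists $\epsilon>0$ such that $S'_q\le S_q$ for all $q\in(1-\epsilon,1)$; this is a partial order on subsets of $\mathbb{N}$. Write $S'\prec S$ if $S'\preceq S$ and $S'\neq S$. A set $S\subseteq\mathbb{N}$ is $D$-avoiding if no two elements of $S$ differ by an element of $D$. A $D$-avoiding set $S$ is germ-maximal if there is no $D$-avoiding set $S'$ with $S\prec S'$. A set $S\subseteq\mathbb{N}$ is eventually periodic (equivalently called rational) iff there exist $N\in\mathbb{N}$ and $d\ge 1$ such that for all $n\ge N$, $n\in S$ iff $n+d\in S$. *)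

theory Defs
  imports "HOL-Analysis.Analysis"
begin

definition gen_sum :: "nat set \<Rightarrow> real \<Rightarrow> real" where
  "gen_sum S q = (\<Sum>\<^sub>\<infinity>n\<in>S. q ^ n)"

text \<open>
  The sums are only meaningful for \<open>0 < q < 1\<close>. Quantifying over \<open>1 - \<epsilon> < q < 1\<close> without the
  constraint \<open>\<epsilon> \<le> 1\<close> is harmless: any witness \<open>\<epsilon>\<close> may be replaced by a smaller one.
\<close>

definition germ_le :: "nat set \<Rightarrow> nat set \<Rightarrow> bool" where
  "germ_le S' S \<longleftrightarrow> (\<exists>\<epsilon>>0. \<forall>q\<in>{1 - \<epsilon><..<1}. gen_sum S' q \<le> gen_sum S q)"

definition germ_less :: "nat set \<Rightarrow> nat set \<Rightarrow> bool" where
  "germ_less S' S \<longleftrightarrow> germ_le S' S \<and> S' \<noteq> S"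

definition avoiding :: "nat set \<Rightarrow> nat set \<Rightarrow> bool" where
  "avoiding D S \<longleftrightarrow> (\<forall>a\<in>S. \<forall>b\<in>S. a < b \<longrightarrow> b - a \<notin> D)"

definition germ_maximal :: "nat set \<Rightarrow> nat set \<Rightarrow> bool" where
  "germ_maximal D S \<longleftrightarrow> avoiding D S \<and> \<not> (\<exists>S'. avoiding D S' \<and> germ_less S S')"

definition eventually_periodic :: "nat set \<Rightarrow> bool" where
  "eventually_periodic S \<longleftrightarrow> (\<exists>N. \<exists>d\<ge>1. \<forall>n\<ge>N. n \<in> S \<longleftrightarrow> n + d \<in> S)"

end

theory Submission
  imports Defs "HOL-Computational_Algebra.Polynomial"
begin

text \<open>
  A single eventually periodic \<open>D\<close>-avoiding set \<open>R\<close> lies germ-above every \<open>D\<close>-avoiding set. A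
  germ-maximal \<open>S\<close> then satisfies \<open>germ_le S R\<close>, so \<open>S = R\<close>.

  Let \<open>m\<close> bound \<open>D\<close>. A \<open>D\<close>-avoiding set is an infinite walk in a finite graph whose vertices are the
  windows of length \<open>m\<close>, and \<open>gen_sum _ q\<close> is a discounted reward along the walk. As in Blackwell's
  theory of discounted decision processes, two facts combine.

  At a fixed \<open>q\<close>, finitely many walks suffice to reach the optimal reward, and they can be chosen
  independently of \<open>q\<close>. Every walk closes a loop within its first \<open>2 ^ m\<close> steps. One can either cut the
  loop out or go round it forever, and \<open>gen_sum_loop_identity\<close> exhibits the reward of the original
  walk as a convex combination of the rewards of these two. If the original walk is almost optimal,
  then cutting cannot gain much, so repeating cannot lose much; but repeating leads to an eventually
  periodic set whose preperiod and period sum to at most \<open>2 ^ m\<close>, and there are only finitely many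
  of those. This is \<open>dominated_by_periodic_set\<close>.

  As \<open>q\<close> tends to \<open>1\<close>, the best of these finitely many sets stabilises: their sums are rational
  functions of \<open>q\<close>, so any two of them are comparable on some interval ending at \<open>1\<close>
  (\<open>germ_le_total_periodic\<close>), and a finite family has a greatest member. That member is \<open>R\<close>.
\<close>

section \<open>Tails and eventually periodic sets\<close>

text \<open>
  Eventual periodicity becomes the equation \<open>tail (a + d) R = tail a R\<close>, and splitting off an
  initial segment becomes an affine relation between sums (\<open>gen_sum_split\<close>); all computations
  with generating sums below reduce to such relations.
\<close>

definition tail :: "nat \<Rightarrow> nat set \<Rightarrow> nat set" where
  "tail k S = {n. n + k \<in> S}"

lemma tail_tail: "tail j (tail k S) = tail (k + j) S"
  by (simp add: tail_def ac_simps)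

lemma summable_on_powers:
  fixes q :: real
  assumes "0 < q" "q < 1"
  shows "(\<lambda>n. q ^ n) summable_on S"
proof -
  have "(\<lambda>n. q ^ n) summable_on UNIV"
    using assms by (subst summable_on_UNIV_nonneg_real_iff) (auto intro: summable_geometric)
  then show ?thesis
    by (rule summable_on_subset_banach) simp
qed

lemma gen_sum_split:
  assumes "0 < q" "q < 1"
  shows "gen_sum S q = (\<Sum>n\<in>S \<inter> {..<k}. q ^ n) + q ^ k * gen_sum (tail k S) q"
proof -
  have S: "S = (S \<inter> {..<k}) \<union> (\<lambda>n. n + k) ` tail k S"
  proof (intro set_eqI iffI)
    fix x assume "x \<in> S"
    then show "x \<in> (S \<inter> {..<k}) \<union> (\<lambda>n. n + k) ` tail k S"
      by (cases "x < k") (auto simp: tail_def image_iff intro!: exI[of _ "x - k"])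
  qed (auto simp: tail_def)
  have "gen_sum S q = infsum (\<lambda>n. q ^ n) ((S \<inter> {..<k}) \<union> (\<lambda>n. n + k) ` tail k S)"
    unfolding gen_sum_def by (subst S) (rule refl)
  also have "\<dots> = infsum (\<lambda>n. q ^ n) (S \<inter> {..<k})
      + infsum (\<lambda>n. q ^ n) ((\<lambda>n. n + k) ` tail k S)"
    by (rule infsum_Un_disjoint) (auto intro: summable_on_powers assms)
  also have "infsum (\<lambda>n. q ^ n) ((\<lambda>n. n + k) ` tail k S) = q ^ k * gen_sum (tail k S) q"
    unfolding gen_sum_def
    by (subst infsum_reindex)
       (simp_all add: o_def power_add infsum_cmult_left' mult.commute[of "q ^ k"])
  finally show ?thesis by simp
qed

lemma gen_sum_le:
  assumes "0 < q" "q < 1"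
  shows "gen_sum S q \<le> gen_sum UNIV q"
  unfolding gen_sum_def
  using assms by (intro infsum_mono_neutral) (auto intro: summable_on_powers)

text \<open>
  Bounding the sum of preperiod \<open>a\<close> and period \<open>d\<close> makes this family finite, because such a set
  is determined by \<open>a\<close>, \<open>d\<close> and its elements below \<open>a + d\<close>.
\<close>

definition periodic_sets :: "nat set \<Rightarrow> nat \<Rightarrow> nat set set" where
  "periodic_sets D N =
     {R. avoiding D R \<and> (\<exists>a d. 0 < d \<and> a + d \<le> N \<and> tail (a + d) R = tail a R)}"

lemma eventually_periodic_if_tail_eq:
  assumes "0 < d" "tail (a + d) R = tail a R"
  shows "eventually_periodic R"
  unfolding eventually_periodic_def
proof (rule exI[of _ a], rule exI[of _ d], intro conjI allI impI)
  fix n assume "a \<le> n"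
  then show "n \<in> R \<longleftrightarrow> n + d \<in> R"
    using assms(2) unfolding tail_def set_eq_iff mem_Collect_eq
    by (metis add.commute add.left_commute le_Suc_ex)
qed (use assms in auto)

lemma periodic_set_determined:
  assumes "0 < d" "tail (a + d) R = tail a R" "tail (a + d) R' = tail a R'"
    and "R \<inter> {..<a + d} = R' \<inter> {..<a + d}"
  shows "R = R'"
proof (rule set_eqI)
  fix n
  show "n \<in> R \<longleftrightarrow> n \<in> R'"
  proof (induction n rule: less_induct)
    case (less n)
    show ?case
    proof (cases "n < a + d")
      case True
      then show ?thesis using assms(4) by auto
    next
      case False
      define k where "k = n - (a + d)"
      have n: "n = k + (a + d)" using False by (simp add: k_def)
      have "k + (a + d) \<in> Q \<longleftrightarrow> k + a \<in> Q" if "tail (a + d) Q = tail a Q" for Q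
        using that by (auto simp: tail_def set_eq_iff)
      then show ?thesis
        using less.IH[of "k + a"] assms(1-3) n by simp
    qed
  qed
qed

lemma finite_periodic_sets: "finite (periodic_sets D N)"
proof -
  let ?F = "\<lambda>(a, d). {R. 0 < d \<and> tail (a + d) R = tail a R}"
  have "finite (?F (a, d))" for a d :: nat
  proof (rule inj_on_finite[where f = "\<lambda>R. R \<inter> {..<a + d}" and B = "Pow {..<a + d}"])
    show "inj_on (\<lambda>R. R \<inter> {..<a + d}) (?F (a, d))"
      by (rule inj_onI) (auto dest: periodic_set_determined)
  qed auto
  then have "finite (\<Union>p\<in>{..N} \<times> {..N}. ?F p)"
    by (intro finite_UN_I) auto
  moreover have "periodic_sets D N \<subseteq> (\<Union>p\<in>{..N} \<times> {..N}. ?F p)"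
    by (force simp: periodic_sets_def)
  ultimately show ?thesis by (rule rev_finite_subset)
qed

section \<open>Cutting and repeating a loop\<close>

definition cut_loop :: "nat set \<Rightarrow> nat \<Rightarrow> nat \<Rightarrow> nat set" where
  "cut_loop S a d = {n. if n < a then n \<in> S else n + d \<in> S}"

definition repeat_loop :: "nat set \<Rightarrow> nat \<Rightarrow> nat \<Rightarrow> nat set" where
  "repeat_loop S a d = {n. if n < a then n \<in> S else a + (n - a) mod d \<in> S}"

lemma repeat_loop_periodic:
  assumes "a \<le> n"
  shows "n + d \<in> repeat_loop S a d \<longleftrightarrow> n \<in> repeat_loop S a d"
proof -
  have "n + d - a = (n - a) + d" using assms by simp
  then have "(n + d - a) mod d = (n - a) mod d" by (simp only: mod_add_self2)
  then show ?thesis using assms by (simp add: repeat_loop_def)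
qed

lemma tail_repeat_loop: "tail (a + d) (repeat_loop S a d) = tail a (repeat_loop S a d)"
  using repeat_loop_periodic[of a "_ + a"] by (auto simp: tail_def add.assoc)

text \<open>
  Relative to the tail of \<open>S\<close> at \<open>a\<close>, cutting the loop replaces \<open>w + q\<^sup>d t\<close> by \<open>t\<close>, while
  repeating it replaces \<open>w + q\<^sup>d t\<close> by \<open>w / (1 - q\<^sup>d)\<close>, where \<open>w\<close> is the weight of the loop and
  \<open>t\<close> that of what follows it. Thus \<open>S\<close> is a convex combination of the two modified sets, with
  weights \<open>1 - q\<^sup>d\<close> for repeating and \<open>q\<^sup>d\<close> for cutting: at no \<open>q\<close> can both surgeries lose.
\<close>

lemma gen_sum_loop_identity:
  assumes q: "0 < q" "q < 1"
  shows "(1 - q ^ d) * gen_sum (repeat_loop S a d) q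
      = gen_sum S q - q ^ d * gen_sum (cut_loop S a d) q"
proof -
  define P where "P = (\<Sum>n\<in>S \<inter> {..<a}. q ^ n)"
  define w where "w = (\<Sum>n\<in>tail a S \<inter> {..<d}. q ^ n)"
  have heads: "cut_loop S a d \<inter> {..<a} = S \<inter> {..<a}" "repeat_loop S a d \<inter> {..<a} = S \<inter> {..<a}"
    "tail a (repeat_loop S a d) \<inter> {..<d} = tail a S \<inter> {..<d}"
    by (auto simp: cut_loop_def repeat_loop_def tail_def add.commute)
  have tails: "tail a (cut_loop S a d) = tail (a + d) S" "tail d (tail a S) = tail (a + d) S"
    "tail d (tail a (repeat_loop S a d)) = tail a (repeat_loop S a d)"
    by (auto simp: tail_tail tail_repeat_loop) (auto simp: tail_def cut_loop_def add.assoc)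
  have S: "gen_sum S q = P + q ^ a * gen_sum (tail a S) q"
    using gen_sum_split[OF q, of S a] by (simp add: P_def)
  have T: "gen_sum (tail a S) q = w + q ^ d * gen_sum (tail (a + d) S) q"
    using gen_sum_split[OF q, of "tail a S" d] by (simp add: w_def tails)
  have C: "gen_sum (cut_loop S a d) q = P + q ^ a * gen_sum (tail (a + d) S) q"
    using gen_sum_split[OF q, of "cut_loop S a d" a] by (simp add: P_def heads tails)
  have R: "gen_sum (repeat_loop S a d) q = P + q ^ a * gen_sum (tail a (repeat_loop S a d)) q"
    using gen_sum_split[OF q, of "repeat_loop S a d" a] by (simp add: P_def heads)
  have W: "(1 - q ^ d) * gen_sum (tail a (repeat_loop S a d)) q = w"
    using gen_sum_split[OF q, of "tail a (repeat_loop S a d)" d]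
    by (simp add: w_def heads tails algebra_simps)
  have "(1 - q ^ d) * gen_sum (repeat_loop S a d) q
      = (1 - q ^ d) * P + q ^ a * ((1 - q ^ d) * gen_sum (tail a (repeat_loop S a d)) q)"
    by (simp add: R algebra_simps)
  also have "\<dots> = gen_sum S q - q ^ d * gen_sum (cut_loop S a d) q"
    by (simp only: W) (simp add: S T C algebra_simps)
  finally show ?thesis .
qed

text \<open>
  A pair of equal windows makes both surgeries safe: as no forbidden difference exceeds \<open>m\<close>, being
  \<open>D\<close>-avoiding can be checked on stretches of length \<open>m + 1\<close>, and each such stretch of a modified set
  already occurs in \<open>S\<close>, those across a seam because the two windows agree.
\<close>

context
  fixes D S :: "nat set" and m a d :: nat
  assumes D_le: "\<And>x. x \<in> D \<Longrightarrow> x \<le> m"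
    and avoid: "avoiding D S"
    and d: "0 < d"
    and window: "\<And>k. k < m \<Longrightarrow> a + k \<in> S \<longleftrightarrow> a + d + k \<in> S"
begin

lemma window_shift: "a \<le> n \<Longrightarrow> n < a + m \<Longrightarrow> n + d \<in> S \<longleftrightarrow> n \<in> S"
  using window[of "n - a"] by (simp add: add.commute)

lemma avoiding_cut_loop: "avoiding D (cut_loop S a d)"
  unfolding avoiding_def
proof (intro ballI impI notI)
  fix x y assume xy: "x \<in> cut_loop S a d" "y \<in> cut_loop S a d" "x < y" and D: "y - x \<in> D"
  show False
  proof (cases "x < a")
    case True
    then have "y < a + m" using D_le[OF D] by simp
    \<comment> \<open>If \<open>y\<close> has been moved by the cut, it lies in the window at \<open>a\<close>, where the move is invisible.\<close>
    then have "x \<in> S" "y \<in> S"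
      using xy True window_shift[of y] by (auto simp: cut_loop_def split: if_splits)
    then show ?thesis using xy D avoid by (auto simp: avoiding_def)
  next
    case False
    then have "x + d \<in> S" "y + d \<in> S"
      using xy by (auto simp: cut_loop_def)
    moreover have "x + d < y + d" "y + d - (x + d) = y - x"
      using xy by auto
    ultimately show ?thesis using D avoid unfolding avoiding_def by metis
  qed
qed

lemma repeat_loop_agrees: "n < a + d + m \<Longrightarrow> n \<in> repeat_loop S a d \<longleftrightarrow> n \<in> S"
proof (induction n rule: less_induct)
  case (less n)
  show ?case
  proof (cases "n < a + d")
    case True
    then show ?thesis by (auto simp: repeat_loop_def)
  next
    case False
    then obtain k where n: "n = k + d" "a \<le> k"
      using that[of "n - d"] by simp
    then show ?thesis
      using repeat_loop_periodic[of a k] window_shift[of k] less d by simp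
  qed
qed

lemma avoiding_repeat_loop: "avoiding D (repeat_loop S a d)"
proof -
  have "y - x \<notin> D" if "x \<in> repeat_loop S a d" "y \<in> repeat_loop S a d" "x < y" for x y
    using that
  proof (induction y arbitrary: x rule: less_induct)
    case (less y)
    show ?case
    proof
      assume D: "y - x \<in> D"
      show False
      proof (cases "y < a + d + m")
        case True
        then show ?thesis
          using less.prems D avoid repeat_loop_agrees by (auto simp: avoiding_def)
      next
        case False
        then have ge: "a + d \<le> x" using D_le[OF D] by simp
        define u v where "u = x - d" and "v = y - d"
        have uv: "x = u + d" "y = v + d" "a \<le> u" "a \<le> v"
          using ge less.prems by (auto simp: u_def v_def)
        then show ?thesis
          using less.IH[of v u] less.prems D d repeat_loop_periodic by simp
      qed
    qed
  qed
  then show ?thesis by (auto simp: avoiding_def)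
qed

end

section \<open>Optimal sets at a fixed \<open>q\<close>\<close>

text \<open>
  Two positions whose windows of length \<open>m\<close> agree are separated by a loop, and one exists early
  on because there are only \<open>2 ^ m\<close> windows.
\<close>

lemma repeated_window:
  obtains a d where "0 < d" "a + d \<le> 2 ^ m" "\<And>k. k < m \<Longrightarrow> a + k \<in> S \<longleftrightarrow> a + d + k \<in> S"
proof -
  let ?w = "\<lambda>n. {k. k < m \<and> n + k \<in> S}"
  have "card (?w ` {..2 ^ m}) \<le> card (Pow {..<m})"
    by (rule card_mono) auto
  then have "\<not> inj_on ?w {..2 ^ m}"
    by (intro pigeonhole) (simp add: card_Pow)
  then obtain x y where "x \<le> 2 ^ m" "y \<le> 2 ^ m" "x \<noteq> y" "?w x = ?w y"
    by (auto simp: inj_on_def)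
  then obtain a b where "a < b" "b \<le> 2 ^ m" and w: "?w a = ?w b"
    by (metis nat_neq_iff)
  moreover have "a + k \<in> S \<longleftrightarrow> b + k \<in> S" if "k < m" for k
    using w that by (auto simp: set_eq_iff)
  ultimately show thesis
    using that[of "b - a" a] by simp
qed

text \<open>
  Let \<open>M\<close> be the best value in the finite family and \<open>V\<close> the supremum over all \<open>D\<close>-avoiding sets.
  Repeating an early loop of \<open>T\<close> yields at most \<open>M\<close> and cutting it at most \<open>V\<close>, so \<open>T\<close> itself stays
  below a convex combination in which \<open>M\<close> has weight at least \<open>1 - q\<close>, whatever the loop. Passing to
  the supremum over \<open>T\<close> forces \<open>V \<le> M\<close>.
\<close>

lemma dominated_by_periodic_set:
  assumes D_le: "\<And>x. x \<in> D \<Longrightarrow> x \<le> m"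
    and q: "0 < q" "q < 1"
    and S: "avoiding D S"
  shows "\<exists>R\<in>periodic_sets D (2 ^ m). gen_sum S q \<le> gen_sum R q"
proof -
  let ?\<R> = "periodic_sets D (2 ^ m)"
  define V where "V = (SUP T\<in>{T. avoiding D T}. gen_sum T q)"
  define M where "M = Max ((\<lambda>R. gen_sum R q) ` ?\<R>)"
  have bdd: "bdd_above ((\<lambda>T. gen_sum T q) ` {T. avoiding D T})"
    by (rule bdd_aboveI2) (rule gen_sum_le[OF q])
  have V: "gen_sum T q \<le> V" if "avoiding D T" for T
    unfolding V_def using that by (intro cSUP_upper bdd) auto
  have M: "gen_sum R q \<le> M" if "R \<in> ?\<R>" for R
    unfolding M_def using that finite_periodic_sets by (intro Max_ge) auto
  have "tail (0 + 1) {} = tail 0 {}" "0 < (1::nat)" "0 + 1 \<le> (2::nat) ^ m" "avoiding D {}"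
    by (auto simp: tail_def avoiding_def)
  then have "{} \<in> ?\<R>"
    unfolding periodic_sets_def by blast
  then have "M \<in> (\<lambda>R. gen_sum R q) ` ?\<R>"
    unfolding M_def by (intro Max_in finite_imageI finite_periodic_sets) auto
  then obtain R where R: "R \<in> ?\<R>" "gen_sum R q = M" by auto
  have "M \<le> V"
    using V R by (auto simp: periodic_sets_def)
  have gap: "gen_sum T q \<le> V - (1 - q) * (V - M)" if T: "avoiding D T" for T
  proof -
    obtain a d where ad: "0 < d" "a + d \<le> 2 ^ m"
      "\<And>k. k < m \<Longrightarrow> a + k \<in> T \<longleftrightarrow> a + d + k \<in> T"
      using repeated_window[where S = T and m = m] by metis
    note loop = D_le T ad(1,3)
    have "repeat_loop T a d \<in> ?\<R>"
      using avoiding_repeat_loop[OF loop] tail_repeat_loop[of a d T] ad(1,2)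
      unfolding periodic_sets_def by blast
    then have "(1 - q ^ d) * gen_sum (repeat_loop T a d) q \<le> (1 - q ^ d) * M"
      using q by (intro mult_left_mono M) (auto simp: power_le_one)
    moreover have "q ^ d * gen_sum (cut_loop T a d) q \<le> q ^ d * V"
      using q by (intro mult_left_mono V avoiding_cut_loop[OF loop]) auto
    ultimately have "gen_sum T q \<le> (1 - q ^ d) * M + q ^ d * V"
      using gen_sum_loop_identity[OF q, of d T a] by simp
    also have "\<dots> = V - (1 - q ^ d) * (V - M)"
      by (simp add: algebra_simps)
    also have "\<dots> \<le> V - (1 - q) * (V - M)"
    proof -
      have "q ^ d \<le> q ^ 1"
        using q ad(1) by (intro power_decreasing) auto
      then have "(1 - q) * (V - M) \<le> (1 - q ^ d) * (V - M)"
        using \<open>M \<le> V\<close> by (intro mult_right_mono) auto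
      then show ?thesis by simp
    qed
    finally show ?thesis .
  qed
  have "(SUP T\<in>{T. avoiding D T}. gen_sum T q) \<le> V - (1 - q) * (V - M)"
    using S gap by (intro cSUP_least) auto
  then have "V \<le> V - (1 - q) * (V - M)"
    by (simp flip: V_def)
  then have "(1 - q) * (V - M) \<le> 0" by simp
  then have "V \<le> M"
    using q by (simp add: mult_le_0_iff)
  then show ?thesis
    using V[OF S] R by (intro bexI[of _ R]) auto
qed

section \<open>Comparing eventually periodic sets near \<open>q = 1\<close>\<close>

lemma germ_le_iff_eventually:
  "germ_le S' S \<longleftrightarrow> (\<forall>\<^sub>F q in at_left 1. gen_sum S' q \<le> gen_sum S q)"
proof
  assume "germ_le S' S"
  then obtain e where "e > 0" "\<forall>q\<in>{1 - e<..<1}. gen_sum S' q \<le> gen_sum S q"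
    by (auto simp: germ_le_def)
  then show "\<forall>\<^sub>F q in at_left 1. gen_sum S' q \<le> gen_sum S q"
    by (auto simp: eventually_at_left_field intro!: exI[of _ "1 - e"])
next
  assume "\<forall>\<^sub>F q in at_left 1. gen_sum S' q \<le> gen_sum S q"
  then obtain c where "c < 1" "\<forall>q>c. q < 1 \<longrightarrow> gen_sum S' q \<le> gen_sum S q"
    by (auto simp: eventually_at_left_field)
  then show "germ_le S' S"
    by (auto simp: germ_le_def intro!: exI[of _ "1 - c"])
qed

lemma eventually_unit_interval: "\<forall>\<^sub>F q in at_left (1::real). 0 < q \<and> q < 1"
  by (auto simp: eventually_at_left_field intro!: exI[of _ 0])

text \<open>
  A nonzero polynomial has a largest root below \<open>c\<close>, if any, and by the intermediate value theorem
  it cannot change sign between that root and \<open>c\<close>.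
\<close>

lemma poly_eventually_has_sign:
  fixes p :: "real poly"
  shows "(\<forall>\<^sub>F x in at_left c. 0 \<le> poly p x) \<or> (\<forall>\<^sub>F x in at_left c. poly p x \<le> 0)"
proof (cases "p = 0")
  case False
  \<comment> \<open>The point \<open>c - 1\<close> only serves to make the set nonempty.\<close>
  define e where "e = Max (insert (c - 1) {x. poly p x = 0 \<and> x < c})"
  have fin: "finite (insert (c - 1) {x. poly p x = 0 \<and> x < c})"
    using poly_roots_finite[OF False] by auto
  have "e \<in> insert (c - 1) {x. poly p x = 0 \<and> x < c}"
    unfolding e_def by (rule Max_in[OF fin]) simp
  then have "e < c" by auto
  have no_root: "poly p x \<noteq> 0" if "e < x" "x < c" for x
    using Max_ge[OF fin, of x] that by (auto simp: e_def)
  have "(\<forall>x. e < x \<and> x < c \<longrightarrow> 0 \<le> poly p x) \<or> (\<forall>x. e < x \<and> x < c \<longrightarrow> poly p x \<le> 0)"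
  proof (rule ccontr)
    assume "\<not> ?thesis"
    then obtain x y where xy: "e < x" "x < c" "poly p x < 0" "e < y" "y < c" "0 < poly p y"
      by force
    then consider "x < y" | "y < x" by fastforce
    then show False
    proof cases
      case 1
      then show ?thesis using poly_IVT_pos[of x y p] xy no_root by force
    next
      case 2
      then show ?thesis using poly_IVT_neg[of y x p] xy no_root by force
    qed
  qed
  then show ?thesis
    using \<open>e < c\<close> by (auto simp: eventually_at_left_field)
qed simp

text \<open>
  Splitting at \<open>a\<close> and at \<open>a + d\<close> expresses the sum in two ways through that of the same tail;
  eliminating the tail leaves a polynomial.
\<close>

lemma gen_sum_rational:
  assumes "tail (a + d) R = tail a R"
  obtains p where "\<And>q. 0 < q \<Longrightarrow> q < 1 \<Longrightarrow> (1 - q ^ d) * gen_sum R q = poly p q"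
proof
  fix q :: real assume q: "0 < q" "q < 1"
  let ?P = "\<lambda>A. \<Sum>n\<in>A. monom (1::real) n"
  have "gen_sum R q = poly (?P (R \<inter> {..<a})) q + q ^ a * gen_sum (tail a R) q"
    using gen_sum_split[OF q, of R a] by (simp add: poly_sum poly_monom)
  moreover have "gen_sum R q = poly (?P (R \<inter> {..<a + d})) q + q ^ (a + d) * gen_sum (tail a R) q"
    using gen_sum_split[OF q, of R "a + d"] by (simp add: poly_sum poly_monom assms)
  ultimately show "(1 - q ^ d) * gen_sum R q
      = poly (?P (R \<inter> {..<a + d}) - monom 1 d * ?P (R \<inter> {..<a})) q"
    by (simp add: poly_monom power_add algebra_simps)
qed

lemma germ_le_total_periodic:
  assumes R: "0 < d" "tail (a + d) R = tail a R"
    and R': "0 < d'" "tail (a' + d') R' = tail a' R'"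
  shows "germ_le R R' \<or> germ_le R' R"
proof -
  obtain p where p: "\<And>q. 0 < q \<Longrightarrow> q < 1 \<Longrightarrow> (1 - q ^ d) * gen_sum R q = poly p q"
    using gen_sum_rational[OF R(2)] by metis
  obtain p' where p': "\<And>q. 0 < q \<Longrightarrow> q < 1 \<Longrightarrow> (1 - q ^ d') * gen_sum R' q = poly p' q"
    using gen_sum_rational[OF R'(2)] by metis
  \<comment> \<open>Clearing the positive denominators turns the difference of the two sums into a polynomial.\<close>
  define h where "h = (1 - monom 1 d') * p - (1 - monom 1 d) * p'"
  have h: "poly h q = (1 - q ^ d) * (1 - q ^ d') * (gen_sum R q - gen_sum R' q)"
      and pos: "0 < (1 - q ^ d) * (1 - q ^ d')"
    if q: "0 < q \<and> q < 1" for q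
  proof -
    show "poly h q = (1 - q ^ d) * (1 - q ^ d') * (gen_sum R q - gen_sum R' q)"
      using q by (simp add: h_def poly_monom flip: p p') (simp add: algebra_simps)
    show "0 < (1 - q ^ d) * (1 - q ^ d')"
      using q R(1) R'(1) by (simp add: power_less_one_iff)
  qed
  consider "\<forall>\<^sub>F q in at_left 1. 0 \<le> poly h q" | "\<forall>\<^sub>F q in at_left 1. poly h q \<le> 0"
    using poly_eventually_has_sign by blast
  then show ?thesis
  proof cases
    case 1
    then have "germ_le R' R"
      unfolding germ_le_iff_eventually using eventually_unit_interval
    proof eventually_elim
      case (elim q)
      then show ?case using h[OF elim(2)] pos[OF elim(2)]
        by (metis diff_ge_0_iff_ge mult_le_cancel_left_pos mult_zero_right)
    qed
    then show ?thesis ..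
  next
    case 2
    then have "germ_le R R'"
      unfolding germ_le_iff_eventually using eventually_unit_interval
    proof eventually_elim
      case (elim q)
      then show ?case using h[OF elim(2)] pos[OF elim(2)]
        by (metis diff_le_0_iff_le mult_le_cancel_left_pos mult_zero_right)
    qed
    then show ?thesis ..
  qed
qed

lemma germ_le_trans: "germ_le A B \<Longrightarrow> germ_le B C \<Longrightarrow> germ_le A C"
  unfolding germ_le_iff_eventually by (auto elim: eventually_elim2)

lemma finite_germ_greatest:
  assumes "finite \<R>" "\<R> \<noteq> {}"
    and total: "\<And>R R'. R \<in> \<R> \<Longrightarrow> R' \<in> \<R> \<Longrightarrow> germ_le R R' \<or> germ_le R' R"
  shows "\<exists>R\<in>\<R>. \<forall>R'\<in>\<R>. germ_le R' R"
  using assms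
proof (induction rule: finite_ne_induct)
  case (singleton R)
  then show ?case by auto
next
  case (insert R F)
  then obtain G where G: "G \<in> F" "\<forall>R'\<in>F. germ_le R' G" by auto
  then consider "germ_le R G" | "germ_le G R" using insert.prems by blast
  then show ?case
  proof cases
    case 1
    then show ?thesis using G by auto
  next
    case 2
    then have "\<forall>R'\<in>insert R F. germ_le R' R"
      using G insert.prems germ_le_trans by blast
    then show ?thesis by auto
  qed
qed

section \<open>Rationality of germ-maximal sets\<close>

theorem theorem7:
  fixes D S :: "nat set"
  assumes "finite D"
    and "\<forall>d\<in>D. 0 < d"
    and "germ_maximal D S"
  shows "eventually_periodic S"
proof -
  obtain m where m: "\<And>x. x \<in> D \<Longrightarrow> x \<le> m"
    using assms(1) finite_nat_set_iff_bounded_le by auto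
  let ?\<R> = "periodic_sets D (2 ^ m)"
  have S: "avoiding D S" and maximal: "\<And>T. avoiding D T \<Longrightarrow> germ_le S T \<Longrightarrow> S = T"
    using assms(3) by (auto simp: germ_maximal_def germ_less_def)
  have dominated: "\<exists>R\<in>?\<R>. gen_sum S q \<le> gen_sum R q" if "0 < q \<and> q < 1" for q
    using dominated_by_periodic_set[OF m _ _ S] that by auto
  then have nonempty: "?\<R> \<noteq> {}" using dominated[of "1 / 2"] by fastforce
  have total: "germ_le R R' \<or> germ_le R' R" if R: "R \<in> ?\<R>" and R': "R' \<in> ?\<R>" for R R'
  proof -
    obtain a d where "0 < d" "tail (a + d) R = tail a R"
      using R by (auto simp: periodic_sets_def)
    moreover obtain a' d' where "0 < d'" "tail (a' + d') R' = tail a' R'"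
      using R' by (auto simp: periodic_sets_def)
    ultimately show ?thesis by (rule germ_le_total_periodic)
  qed
  obtain R where R: "R \<in> ?\<R>" and greatest: "\<forall>R'\<in>?\<R>. germ_le R' R"
    using finite_germ_greatest[OF finite_periodic_sets nonempty total] by blast
  \<comment> \<open>The set that dominates \<open>S\<close> may vary with \<open>q\<close>, but \<open>R\<close> dominates all candidates on one common interval.\<close>
  have "\<forall>\<^sub>F q in at_left 1. \<forall>R'\<in>?\<R>. gen_sum R' q \<le> gen_sum R q"
    using greatest finite_periodic_sets
    by (auto simp: germ_le_iff_eventually intro: eventually_ball_finite)
  then have "germ_le S R"
    unfolding germ_le_iff_eventually using eventually_unit_interval
  proof eventually_elim
    case (elim q)
    then show ?case using dominated[of q] by force
  qed
  then have "S = R" using maximal R by (auto simp: periodic_sets_def)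
  then show ?thesis
    using R eventually_periodic_if_tail_eq by (auto simp: periodic_sets_def)
qed

end
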